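(* Let $\ell$ be a positive integer and suppose $2\ell=pq+r$ for positive integers $p,q$ and an integer $r$ with $p/2\le r\le 20$. Then for every $S\subseteq D_{8\ell+2}\setminus\{e\}$ with $|S|=8\ell$ such that the unique non-identity element of $D_{8\ell+2}$ not in $S$ has the same order as $u^{2\ell-p+1}$, the group $D_{8\ell+2}$ has an $S$-sequencing.
   Context: $D_{2m}=\langle u,v : u^m=e=v^2,\ vu=u^{m-1}v\rangle$ is the dihedral group of order $2m$. For $S\subseteq G\setminus\{e\}$ with $|S|=k$, an $S$-sequencing of $G$ is an ordering $(g_1,\dots,g_k)$ of the elements of $S$ such that the partial products $h_0=e$, $h_i=g_1\cdots g_i$ ($1\le i\le k$) are pairwise distinct. *)

theory Defs
  imports "HOL-Algebra.Multiplicative_Group"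
begin

text \<open>The dihedral group D_{2m} = <u,v : u^m = e = v^2, vu = u^(m-1) v>.
  The element u^i v^a (0 <= i < m, a in {0,1}) is represented by the pair (i, a),
  with a :: bool (True meaning the factor v is present).
  Since v u^j = u^(-j) v we get (u^i v^a)(u^j v^b) = u^(i + (-1)^a j) v^(a+b).\<close>

definition dihedral :: "nat \<Rightarrow> (nat \<times> bool) monoid" where
  "dihedral m = \<lparr> carrier = {0..<m} \<times> UNIV,
     mult = (\<lambda>(i, a) (j, b). ((if a then i + (m - j) else i + j) mod m, a \<noteq> b)),
     one = (0, False) \<rparr>"

definition dih_u :: "nat \<Rightarrow> nat \<times> bool" where
  "dih_u m = (1 mod m, False)"

definition partial_prod :: "('a, 'b) monoid_scheme \<Rightarrow> 'a list \<Rightarrow> nat \<Rightarrow> 'a" where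
  "partial_prod G gs i = foldl (mult G) (one G) (take i gs)"

definition is_S_sequencing :: "('a, 'b) monoid_scheme \<Rightarrow> 'a set \<Rightarrow> 'a list \<Rightarrow> bool" where
  "is_S_sequencing G S gs \<longleftrightarrow>
     distinct gs \<and> set gs = S \<and>
     inj_on (partial_prod G gs) {0..length gs}"

definition has_S_sequencing :: "('a, 'b) monoid_scheme \<Rightarrow> 'a set \<Rightarrow> bool" where
  "has_S_sequencing G S \<longleftrightarrow> (\<exists>gs. is_S_sequencing G S gs)"

end

theory Submission
  imports Defs "HOL-Computational_Algebra.Primes"
begin

text \<open>
  Call an ordering of $0, \dots, N-1$ graceful if the gaps between consecutive entries are
  $1, \dots, N-1$ in some order. Let $N = 2l$ and $m = 2N+1$, and let $g$ be a graceful ordering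
  that ends in the middle, at $l$. Walk along the rotations $u^{g_k-N}$, jump from $u^{l-N}$ to
  $u^l$, alternate between the rotations $u^i$ and the reflections $u^{-j}v$ with
  $0 \le i, j \le N$ so that $i+j$ takes each value once, and jump from $u^{-l}v$ to the
  reflections $u^{N-g_k}v$, which are visited in reverse order. The first and the last part produce
  the differences of $g$ and their negatives, the jumps produce $u^N$ and $u^{-N}$, and the middle
  part produces every reflection once; so this is a sequencing of the whole group. Omitting its
  first vertex loses just $u^{g_2-g_1}$.

  If $N = pq + r$, then reversing each of the first $q$ blocks of $p$ entries of the zigzag
  $0, N-1, 1, N-2, \dots$ gives the start of a graceful ordering with first gap $N+1-p$; it can be
  completed by a graceful ordering of $r$ numbers with a prescribed first entry, which is where
  $p/2 \le r \le 20$ enters. Every other rotation of the same order is reached by an automorphism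
  $u \mapsto u^c$.\<close>

section \<open>Paths in the dihedral group\<close>

text \<open>The pair $(i, a)$ of an integer and a truth value stands for $u^{ci}v^a$, the image of $u^iv^a$
  under $u \mapsto u^c$. If two pairs stand for $g$ and $h$, then their \<open>lab\<close> stands for
  $g^{-1}h$.\<close>

definition red :: "int \<Rightarrow> nat \<Rightarrow> int \<times> bool \<Rightarrow> nat \<times> bool" where
  "red c m v = (nat (c * fst v mod int m), snd v)"

definition lab :: "int \<times> bool \<Rightarrow> int \<times> bool \<Rightarrow> int \<times> bool" where
  "lab v w = (if snd v then fst v - fst w else fst w - fst v, snd v \<noteq> snd w)"

definition steps :: "('a \<Rightarrow> 'a \<Rightarrow> 'b) \<Rightarrow> 'a list \<Rightarrow> 'b list" where
  "steps f xs = map2 f xs (tl xs)"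

lemma steps_simps [simp]:
  "steps f [] = []" "steps f [x] = []" "steps f (x # y # zs) = f x y # steps f (y # zs)"
  by (simp_all add: steps_def)

lemma length_steps [simp]: "length (steps f xs) = length xs - 1"
  by (simp add: steps_def)

lemma steps_append:
  "xs \<noteq> [] \<Longrightarrow> ys \<noteq> [] \<Longrightarrow>
    steps f (xs @ ys) = steps f xs @ f (last xs) (hd ys) # steps f ys"
proof (induction xs rule: induct_list012)
  case (2 x)
  then show ?case by (cases ys) auto
qed auto

lemma steps_rev: "steps f (rev xs) = rev (steps (\<lambda>x y. f y x) xs)"
proof (induction xs rule: induct_list012)
  case (3 x y zs)
  then show ?case
    using steps_append[of "rev (y # zs)" "[x]" f] by simp
qed auto

lemma steps_map: "steps f (map g xs) = steps (\<lambda>x y. f (g x) (g y)) xs"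
  by (induction xs rule: induct_list012) auto

lemma map_steps: "map g (steps f xs) = steps (\<lambda>x y. g (f x y)) xs"
  by (induction xs rule: induct_list012) auto

section \<open>Arithmetic of the dihedral group on integer pairs\<close>

lemma dihedral_simps:
  "carrier (dihedral m) = {0..<m} \<times> UNIV"
  "\<one>\<^bsub>dihedral m\<^esub> = (0, False)"
  "(i, a) \<otimes>\<^bsub>dihedral m\<^esub> (j, b) = ((if a then i + (m - j) else i + j) mod m, a \<noteq> b)"
  by (simp_all add: dihedral_def)

lemma red_in_carrier: "m > 0 \<Longrightarrow> red c m v \<in> carrier (dihedral m)"
  by (simp add: red_def dihedral_simps nat_less_iff)

lemma red_surj:
  assumes "g \<in> carrier (dihedral m)"
  obtains v where "g = red 1 m v"
proof
  show "g = red 1 m (int (fst g), snd g)"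
    using assms by (auto simp: red_def dihedral_simps)
qed

lemma mult_red:
  assumes "m > 0"
  shows "red c m v \<otimes>\<^bsub>dihedral m\<^esub> red c m w =
    red c m (if snd v then fst v - fst w else fst v + fst w, snd v \<noteq> snd w)"
proof -
  define i where "i = nat (c * fst v mod int m)"
  define j where "j = nat (c * fst w mod int m)"
  have i: "int i = c * fst v mod int m" and j: "int j = c * fst w mod int m" "j < m"
    using assms by (simp_all add: i_def j_def nat_less_iff)
  have "int ((i + (m - j)) mod m) = (int i - int j + int m) mod int m"
    using j(2) by (simp add: zmod_int of_nat_diff algebra_simps)
  also have "\<dots> = (int i - int j) mod int m"
    by simp
  also have "\<dots> = c * (fst v - fst w) mod int m"
    by (simp add: i j mod_diff_eq right_diff_distrib)
  finally have A: "(i + (m - j)) mod m = nat (c * (fst v - fst w) mod int m)"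
    by (metis nat_int)
  have "int ((i + j) mod m) = c * (fst v + fst w) mod int m"
    by (simp add: zmod_int i j mod_add_eq distrib_left)
  then have B: "(i + j) mod m = nat (c * (fst v + fst w) mod int m)"
    by (metis nat_int)
  show ?thesis
    using A B by (simp add: red_def dihedral_simps flip: i_def j_def)
qed

lemma mult_red_lab:
  "m > 0 \<Longrightarrow> red c m v \<otimes>\<^bsub>dihedral m\<^esub> red c m (lab v w) = red c m w"
  by (auto simp: mult_red lab_def)

lemma group_dihedral:
  assumes "m > 0"
  shows "group (dihedral m)"
proof (rule groupI)
  have one: "\<one>\<^bsub>dihedral m\<^esub> = red 1 m (0, False)"
    by (simp add: red_def dihedral_simps)
  show "\<one>\<^bsub>dihedral m\<^esub> \<in> carrier (dihedral m)"
    using assms by (simp add: dihedral_simps)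
  fix x y z
  assume xyz: "x \<in> carrier (dihedral m)"
  then obtain u where u: "x = red 1 m u" by (rule red_surj)
  show "\<one>\<^bsub>dihedral m\<^esub> \<otimes>\<^bsub>dihedral m\<^esub> x = x"
    using assms by (simp add: one u mult_red)
  show "\<exists>y\<in>carrier (dihedral m). y \<otimes>\<^bsub>dihedral m\<^esub> x = \<one>\<^bsub>dihedral m\<^esub>"
  proof
    show "red 1 m (if snd u then u else (- fst u, False)) \<otimes>\<^bsub>dihedral m\<^esub> x = \<one>\<^bsub>dihedral m\<^esub>"
      using assms by (simp add: one u mult_red)
  qed (use assms in \<open>simp add: red_in_carrier\<close>)
  assume "y \<in> carrier (dihedral m)"
  then obtain v where v: "y = red 1 m v" by (rule red_surj)
  show "x \<otimes>\<^bsub>dihedral m\<^esub> y \<in> carrier (dihedral m)"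
    using assms by (simp add: u v mult_red red_in_carrier)
  assume "z \<in> carrier (dihedral m)"
  then obtain w where w: "z = red 1 m w" by (rule red_surj)
  show "x \<otimes>\<^bsub>dihedral m\<^esub> y \<otimes>\<^bsub>dihedral m\<^esub> z = x \<otimes>\<^bsub>dihedral m\<^esub> (y \<otimes>\<^bsub>dihedral m\<^esub> z)"
    using assms by (auto simp: u v w mult_red algebra_simps)
qed

lemma foldl_steps_lab:
  assumes "m > 0" and "i < length vs"
  shows "foldl (\<otimes>\<^bsub>dihedral m\<^esub>) (red c m (hd vs)) (take i (map (red c m) (steps lab vs))) =
    red c m (vs ! i)"
  using assms(2)
proof (induction vs arbitrary: i rule: induct_list012)
  case (3 v w vs)
  then show ?case
    using mult_red_lab[OF assms(1)] by (cases i) auto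
qed auto

lemma (in group) foldl_mult_assoc:
  assumes "set xs \<subseteq> carrier G" and "a \<in> carrier G" and "b \<in> carrier G"
  shows "foldl (\<otimes>) (a \<otimes> b) xs = a \<otimes> foldl (\<otimes>) b xs"
  using assms by (induction xs arbitrary: b) (auto simp: m_assoc)

section \<open>From integer paths to sequencings\<close>

lemma inj_mod_on_interval:
  fixes a :: int
  assumes "coprime c (int m)"
  shows "inj_on (\<lambda>i. c * i mod int m) {a..<a + int m}"
proof (rule inj_onI)
  fix i j assume ij: "i \<in> {a..<a + int m}" "j \<in> {a..<a + int m}"
    and "c * i mod int m = c * j mod int m"
  then have "int m dvd c * (i - j)"
    by (simp add: mod_eq_dvd_iff right_diff_distrib)
  then have "int m dvd i - j"
    using assms coprime_dvd_mult_right_iff coprime_commute by blast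
  moreover have "\<bar>i - j\<bar> < int m" using ij by auto
  ultimately show "i = j"
    using dvd_imp_le_int[of "i - j" "int m"] by linarith
qed

text \<open>One complete residue system modulo \<open>m\<close> for the rotations and one for the
  reflections, offset independently. Inside a window \<open>red\<close> is injective for every unit
  \<open>c\<close>, so distinctness can be checked on integers.\<close>

definition window :: "nat \<Rightarrow> int \<Rightarrow> int \<Rightarrow> (int \<times> bool) set" where
  "window m a b = {a..<a + int m} \<times> {False} \<union> {b..<b + int m} \<times> {True}"

lemma inj_on_red:
  assumes "coprime c (int m)" and "m > 0"
  shows "inj_on (red c m) (window m a b)"
proof (rule inj_onI)
  fix v w assume "v \<in> window m a b" "w \<in> window m a b" and eq: "red c m v = red c m w"
  then obtain e where "fst v \<in> {e..<e + int m}" "fst w \<in> {e..<e + int m}"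
    by (auto simp: window_def red_def)
  moreover have "c * fst v mod int m = c * fst w mod int m"
    using eq assms(2) by (simp add: red_def eq_nat_nat_iff)
  ultimately have "fst v = fst w"
    using inj_onD[OF inj_mod_on_interval[OF assms(1)]] by blast
  then show "v = w" using eq by (simp add: red_def prod_eq_iff)
qed

text \<open>The \<open>2 * m - 1\<close> vertices give \<open>2 * m - 2\<close> distinct labels that
  avoid two elements, so by counting the labels exhaust the rest of the group. The partial products
  are the vertices translated by the inverse of the first vertex, hence distinct; the path may start
  anywhere.\<close>

lemma sequencing_of_path:
  assumes m: "m > 0" and c: "coprime c (int m)"
    and len: "length vs = 2 * m - 1"
    and vs: "distinct vs" "set vs \<subseteq> window m a b"
    and ls: "distinct (steps lab vs)" "set (steps lab vs) \<subseteq> window m a' b'"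
    and ex: "(0, False) \<notin> set (steps lab vs)" "(t, False) \<notin> set (steps lab vs)"
      "(t, False) \<in> window m a' b'" "(0, False) \<in> window m a' b'" "t \<noteq> 0"
  shows "has_S_sequencing (dihedral m) (carrier (dihedral m) - {\<one>\<^bsub>dihedral m\<^esub>, red c m (t, False)})"
proof -
  let ?G = "dihedral m"
  interpret group ?G using m by (rule group_dihedral)
  define gs where "gs = map (red c m) (steps lab vs)"
  have ne: "vs \<noteq> []" using len m by auto
  have inj: "inj_on (red c m) (window m a' b')" using c m by (rule inj_on_red)
  have gs_carrier: "set gs \<subseteq> carrier ?G"
    using m by (auto simp: gs_def red_in_carrier)
  have dist: "distinct gs"
    unfolding gs_def using ls inj by (simp add: distinct_map inj_on_subset)
  have one: "\<one>\<^bsub>?G\<^esub> = red c m (0, False)"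
    by (simp add: red_def dihedral_simps)
  have notin: "red c m (s, False) \<notin> set gs"
    if "(s, False) \<notin> set (steps lab vs)" "(s, False) \<in> window m a' b'" for s
    using that ls(2) inj by (auto simp: gs_def dest: inj_onD)
  let ?S = "carrier ?G - {\<one>\<^bsub>?G\<^esub>, red c m (t, False)}"
  have ne2: "\<one>\<^bsub>?G\<^esub> \<noteq> red c m (t, False)"
    using inj_onD[OF inj, of "(0, False)" "(t, False)"] ex one by auto
  have fin: "finite (carrier ?G)" and card: "card (carrier ?G) = 2 * m"
    by (simp_all add: dihedral_simps card_cartesian_product)
  have "card ?S = 2 * m - 2"
    using ne2 card fin m red_in_carrier[OF m] by (subst card_Diff_subset) auto
  moreover have "card (set gs) = 2 * m - 2"
    using distinct_card[OF dist] len by (simp add: gs_def)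
  moreover have "set gs \<subseteq> ?S"
    using gs_carrier notin ex one by auto
  ultimately have S: "set gs = ?S"
    using fin by (intro card_subset_eq) auto
  have "inj_on (partial_prod ?G gs) {0..length gs}"
  proof (rule inj_onI)
    have less: "length gs < length vs" using ne by (simp add: gs_def)
    fix i j assume ij: "i \<in> {0..length gs}" "j \<in> {0..length gs}"
      and eq: "partial_prod ?G gs i = partial_prod ?G gs j"
    have i: "i < length vs" and j: "j < length vs" using ij less by simp_all
    have hd: "red c m (hd vs) \<in> carrier ?G" using m by (rule red_in_carrier)
    have prods: "red c m (vs ! k) = red c m (hd vs) \<otimes>\<^bsub>?G\<^esub> partial_prod ?G gs k"
      if "k < length vs" for k
    proof -
      have "set (take k gs) \<subseteq> carrier ?G"
        using set_take_subset gs_carrier by (rule subset_trans)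
      then have "foldl (\<otimes>\<^bsub>?G\<^esub>) (red c m (hd vs)) (take k gs) =
          red c m (hd vs) \<otimes>\<^bsub>?G\<^esub> partial_prod ?G gs k"
        using foldl_mult_assoc[of "take k gs" "red c m (hd vs)" "\<one>\<^bsub>?G\<^esub>"] hd
        by (simp only: partial_prod_def r_one one_closed)
      then show ?thesis
        using foldl_steps_lab[OF m that, of c] by (simp only: gs_def)
    qed
    have "red c m (vs ! i) = red c m (vs ! j)"
      by (simp only: prods[OF i] prods[OF j] eq)
    then have "vs ! i = vs ! j"
      using inj_onD[OF inj_on_red[OF c m, of a b]] subsetD[OF vs(2)] nth_mem[OF i] nth_mem[OF j] by blast
    then show "i = j" using vs(1) i j nth_eq_iff_index_eq by blast
  qed
  then show ?thesis
    using dist S by (auto simp: has_S_sequencing_def is_S_sequencing_def)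
qed

section \<open>Graceful orderings\<close>

text \<open>Distinctness suffices: n distinct entries fill the interval, and the n - 1 distinct gaps
  lie between 1 and n - 1, so each value occurs.\<close>

definition graceful :: "int list \<Rightarrow> bool" where
  "graceful xs \<longleftrightarrow> distinct xs \<and> set xs \<subseteq> {0..<int (length xs)} \<and>
     distinct (steps (\<lambda>x y. \<bar>y - x\<bar>) xs)"

text \<open>The ordering $0, n-1, 1, n-2, \dots$ of $\{0, \dots, n-1\}$, indexed from 0.\<close>

definition zigzag :: "int \<Rightarrow> nat \<Rightarrow> int" where
  "zigzag n k = (if even k then int (k div 2) else n - 1 - int (k div 2))"

text \<open>The value \<open>zigzag n (p - 1)\<close>, which lies in $\{0, \dots, n-1\}$ for all $p \le 2n$ and not
  just for $p \le n$: this is the condition $p/2 \le r$.\<close>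

definition zigzag_start :: "int \<Rightarrow> nat \<Rightarrow> int" where
  "zigzag_start n p = (if odd p then int (p div 2) else n - int (p div 2))"

text \<open>The pair of values for odd \<open>n\<close> is off-centre because it has to correspond
  to the two middles of an even interval under the reflection in \<open>inner\<close> for odd
  \<open>p\<close>.\<close>

definition near_middle :: "int \<Rightarrow> int \<Rightarrow> bool" where
  "near_middle n e \<longleftrightarrow> (if even n then 2 * e = n \<or> 2 * e = n - 2 else 2 * e = n + 1 \<or> 2 * e = n - 1)"

text \<open>An invariant of prefixing blocks: the prescribed first entry lets another block of
  \<open>p\<close> entries be attached.\<close>

definition twizzled :: "nat \<Rightarrow> int list \<Rightarrow> bool" where
  "twizzled p xs \<longleftrightarrow> xs \<noteq> [] \<and> graceful xs \<and>
     hd xs = zigzag_start (int (length xs)) p \<and> near_middle (int (length xs)) (last xs)"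

text \<open>The first $p$ entries of the zigzag on $r + p$ numbers leave an interval of $r$ numbers; for odd
  $p$ the zigzag continues at its upper end, so the embedding is a reflection.\<close>

definition inner :: "int \<Rightarrow> nat \<Rightarrow> int \<Rightarrow> int" where
  "inner r p v = (if even p then int (p div 2) + v else int (p div 2) + r - v)"

definition twist :: "nat \<Rightarrow> int list \<Rightarrow> int list" where
  "twist p xs = map (zigzag (int (length xs + p))) (rev [0..<p]) @ map (inner (int (length xs)) p) xs"

section \<open>Twisting a graceful ordering\<close>

lemma zigzag_step: "\<bar>zigzag n k - zigzag n (Suc k)\<bar> = \<bar>n - 1 - int k\<bar>"
  by (cases "even k") (auto simp: zigzag_def elim!: evenE oddE)

lemma zigzag_inj:
  assumes "zigzag n j = zigzag n k" "int j < n" "int k < n"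
  shows "j = k"
  using assms by (auto simp: zigzag_def elim!: evenE oddE split: if_splits)

lemma inner_diff: "\<bar>inner r p y - inner r p x\<bar> = \<bar>y - x\<bar>"
  by (auto simp: inner_def)

lemma steps_zigzag:
  assumes "int p \<le> n"
  shows "steps (\<lambda>x y. \<bar>y - x\<bar>) (map (zigzag n) (rev [0..<p])) = map (\<lambda>k. n - 1 - int k) (rev [0..<p - 1])"
  using assms
proof (induction p)
  case (Suc p)
  then show ?case
    using zigzag_step[of n "p - 1"] by (cases p) auto
qed simp

lemma graceful_gap:
  assumes "graceful xs" and "d \<in> set (steps (\<lambda>x y. \<bar>y - x\<bar>) xs)"
  shows "0 < d \<and> d < int (length xs)"
proof -
  \<comment> \<open>The bound is a fixed \<open>n\<close> instead of the length, which changes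
    during the induction.\<close>
  have "\<forall>d\<in>set (steps (\<lambda>x y. \<bar>y - x\<bar>) xs). 0 < d \<and> d < n"
    if "distinct xs" "set xs \<subseteq> {0..<n}" for n
    using that by (induction xs rule: induct_list012) auto
  then show ?thesis using assms by (auto simp: graceful_def)
qed

text \<open>Even indices take the low values and odd ones the high values, so the interval left free
  begins at p/2 rounded up.\<close>

lemma zigzag_range:
  assumes "k < p" and "r \<ge> 0"
  shows "0 \<le> zigzag (r + int p) k \<and> zigzag (r + int p) k < r + int p \<and>
    (zigzag (r + int p) k < int ((p + 1) div 2) \<or> r + int ((p + 1) div 2) \<le> zigzag (r + int p) k)"
proof -
  have half: "int p \<le> 2 * int ((p + 1) div 2)" "2 * int ((p + 1) div 2) \<le> int p + 1"
    by linarith+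
  show ?thesis
  proof (cases "even k")
    case True
    then obtain j where "k = 2 * j" by (rule evenE)
    then show ?thesis using assms half by (simp add: zigzag_def)
  next
    case False
    then obtain j where "k = 2 * j + 1" by (rule oddE)
    then show ?thesis using assms half by (simp add: zigzag_def)
  qed
qed

lemma inner_range:
  assumes "0 \<le> v" and "v < r"
  shows "int ((p + 1) div 2) \<le> inner r p v \<and> inner r p v < r + int ((p + 1) div 2)"
  using assms by (auto simp: inner_def elim!: evenE oddE)

text \<open>The reversed block ends at 0 and the embedded first entry is exactly \<open>r\<close>,
  the gap value between those of the block and those of the old sequence.\<close>

lemma twist_join:
  assumes "p > 0" and "h = zigzag_start r p"
  shows "inner r p h - zigzag (r + int p) 0 = r"
  using assms by (auto simp: inner_def zigzag_start_def zigzag_def)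

lemma length_twist [simp]: "length (twist p xs) = length xs + p"
  by (simp add: twist_def)

text \<open>The block has the gaps r + 1, ..., n - 1, the join has gap r, and the embedding
  preserves the gaps 1, ..., r - 1. The embedded entries fill the interval that the block leaves
  free.\<close>

lemma twisted_graceful:
  assumes xs: "twizzled p xs" and p: "p > 0"
  shows "graceful (twist p xs)"
proof -
  let ?r = "int (length xs)" and ?n = "int (length xs + p)" and ?gap = "\<lambda>x y :: int. \<bar>y - x\<bar>"
  let ?A = "map (zigzag ?n) (rev [0..<p])" and ?B = "map (inner ?r p) xs"
  have ne: "xs \<noteq> []" and g: "graceful xs" and h: "hd xs = zigzag_start ?r p"
    using xs by (auto simp: twizzled_def)
  have d: "distinct xs" "set xs \<subseteq> {0..<?r}"
    using g by (auto simp: graceful_def)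
  have r: "?r > 0" using ne by simp
  have n: "?n = ?r + int p" by simp
  have dA: "distinct ?A"
    using zigzag_inj[of ?n] by (auto simp: distinct_map intro!: inj_onI)
  have "inj (inner ?r p)" by (auto simp: inner_def inj_def)
  then have dB: "distinct ?B"
    using d(1) by (auto simp: distinct_map intro: inj_on_subset)
  have rangeA: "0 \<le> a \<and> a < ?n \<and> (a < int ((p + 1) div 2) \<or> ?r + int ((p + 1) div 2) \<le> a)"
    if "a \<in> set ?A" for a
  proof -
    have "a \<in> zigzag ?n ` {0..<p}" using that by simp
    then obtain k where "a = zigzag ?n k" "k \<in> {0..<p}" by (rule imageE)
    then show ?thesis using zigzag_range[of k p ?r] unfolding n by simp
  qed
  have rangeB: "int ((p + 1) div 2) \<le> b \<and> b < ?r + int ((p + 1) div 2)" if "b \<in> set ?B" for b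
  proof -
    have "b \<in> inner ?r p ` set xs" using that by simp
    then obtain v where v: "b = inner ?r p v" "v \<in> set xs" by (rule imageE)
    then have "0 \<le> v \<and> v < ?r" using d(2) by auto
    then show ?thesis using inner_range[of v ?r p] v(1) by simp
  qed
  have disj: "set ?A \<inter> set ?B = {}"
  proof (rule ccontr)
    assume "set ?A \<inter> set ?B \<noteq> {}"
    then obtain a where "a \<in> set ?A" "a \<in> set ?B" by blast
    then show False using rangeA[of a] rangeB[of a] by linarith
  qed
  have half: "int ((p + 1) div 2) \<le> int p" using p by simp
  have sub: "set ?A \<union> set ?B \<subseteq> {0..<?n}"
  proof
    fix a assume "a \<in> set ?A \<union> set ?B"
    then show "a \<in> {0..<?n}"
    proof
      assume "a \<in> set ?B"
      then show ?thesis using rangeB[of a] half n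
        unfolding atLeastLessThan_iff by linarith
    qed (use rangeA in auto)
  qed
  have last: "last ?A = zigzag ?n 0"
    using p by (cases p) (auto simp: last_map last_rev hd_upt simp del: upt_Suc)
  have hd: "hd ?B = inner ?r p (hd xs)"
    using ne by (simp add: hd_map)
  have "steps ?gap (?A @ ?B) = steps ?gap ?A @ ?gap (last ?A) (hd ?B) # steps ?gap ?B"
    using ne p by (intro steps_append) auto
  also have "?gap (last ?A) (hd ?B) = ?r"
    using twist_join[OF p h] unfolding last hd unfolding n by simp
  also have "steps ?gap ?B = steps ?gap xs"
    by (simp add: steps_map inner_diff)
  also have "steps ?gap ?A = map (\<lambda>k. ?n - 1 - int k) (rev [0..<p - 1])"
    by (rule steps_zigzag) simp
  finally have gaps: "steps ?gap (?A @ ?B) =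
    map (\<lambda>k. ?n - 1 - int k) (rev [0..<p - 1]) @ ?r # steps ?gap xs" .
  have "distinct (steps ?gap (?A @ ?B))"
    unfolding gaps using g
    by (auto simp: distinct_map inj_on_def graceful_def dest!: graceful_gap[OF g])
  then show ?thesis
    using dA dB disj sub by (simp add: graceful_def twist_def add.commute)
qed

lemma twizzled_twist:
  assumes xs: "twizzled p xs" and p: "p > 0"
  shows "twizzled p (twist p xs)"
proof -
  have ne: "xs \<noteq> []" and m: "near_middle (int (length xs)) (last xs)"
    using xs by (auto simp: twizzled_def)
  have "hd (twist p xs) = zigzag_start (int (length xs + p)) p"
    using p by (cases p) (auto simp: twist_def zigzag_def zigzag_start_def)
  moreover have "last (twist p xs) = inner (int (length xs)) p (last xs)"
    using ne by (simp add: twist_def last_map)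
  moreover have "near_middle (int (length xs + p)) (inner (int (length xs)) p (last xs))"
    using m by (auto simp: near_middle_def inner_def elim!: evenE oddE split: if_splits)
  ultimately show ?thesis
    using twisted_graceful[OF xs p] ne by (simp add: twizzled_def) (simp add: twist_def)
qed

text \<open>The gaps of the zigzag decrease, so reversing the block puts its smallest gap
  first.\<close>

lemma twist_first_gap:
  assumes "p > 1"
  shows "\<bar>twist p xs ! 1 - twist p xs ! 0\<bar> = int (length xs) + 1"
proof -
  obtain k where "p = Suc (Suc k)" using assms by (intro that[of "p - 2"]) simp
  then show ?thesis
    using zigzag_step[of "int (length xs + p)" k] by (simp add: twist_def nth_append)
qed

text \<open>For these \<open>r\<close> the sum r(r - 1)/2 of the gaps is even, so the first and last
  entries have equal parity. The two values near the middle are consecutive, so both entries would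
  be the same.\<close>

definition exceptional :: "int \<Rightarrow> int \<Rightarrow> bool" where
  "exceptional r v \<longleftrightarrow> r > 1 \<and> r mod 4 \<le> 1 \<and> near_middle r v"

text \<open>Found by computer search. A graceful sequence of length $r$ cannot both start and end next to the
  middle if $r \equiv 0, 1$ modulo 4, by the parity of the sum of the gaps; for these starting
  points the second table lists sequences that are longer by one period $p$.\<close>

definition seeds :: "int list list" where
"seeds =
  [[0],[0,1],[1,0],[0,2,1],[1,0,2],[2,0,1],[0,3,1,2],[3,0,2,1],[0,4,1,3,2],[1,2,4,0,3],[4,0,3,1,2],
   [0,5,1,4,2,3],[1,3,4,0,5,2],[2,0,5,1,4,3],[3,5,0,4,1,2],[4,1,5,0,2,3],[5,0,4,1,3,2],[0,6,1,5,2,4,3],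
   [1,5,0,6,3,2,4],[2,5,4,0,6,1,3],[3,5,0,6,2,1,4],[4,0,6,1,2,5,3],[5,2,3,1,6,0,4],[6,0,5,1,4,2,3],
   [0,7,1,6,2,5,3,4],[1,7,0,5,2,6,4,3],[2,6,1,7,0,3,5,4],[5,0,7,1,4,6,2,3],[6,0,7,2,3,5,1,4],
   [7,0,6,1,5,2,4,3],[0,8,1,7,2,6,3,5,4],[1,7,0,8,3,6,2,4,5],[2,6,5,3,8,0,7,1,4],[3,0,8,1,7,2,6,4,5],
   [6,0,8,1,3,7,2,5,4],[7,2,4,3,6,0,8,1,5],[8,0,7,1,6,2,5,3,4],[0,9,1,8,2,7,3,6,4,5],[1,8,0,9,3,6,2,7,5,4],
   [2,6,1,8,0,9,3,4,7,5],[3,7,1,6,8,0,9,2,5,4],[4,2,7,6,3,9,0,8,1,5],[5,3,6,7,2,8,1,9,0,4],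
   [6,1,9,0,7,3,4,2,8,5],[7,0,9,1,6,2,8,5,3,4],[8,0,9,2,6,1,7,4,3,5],[9,0,8,1,7,2,6,3,5,4],
   [0,10,1,9,2,8,3,7,4,6,5],[1,8,2,10,0,9,4,7,3,5,6],[2,9,4,8,0,10,1,7,6,3,5],[3,9,1,10,0,7,2,5,4,8,6],
   [4,7,8,1,6,2,10,0,9,3,5],[5,10,0,9,1,8,2,3,7,4,6],[6,7,2,8,4,1,9,0,10,3,5],[7,5,4,0,10,1,9,2,8,3,6],
   [8,1,9,0,10,4,3,6,2,7,5],[9,0,10,2,7,1,8,4,5,3,6],[10,0,9,1,8,2,7,3,6,4,5],[0,11,1,10,2,9,3,8,4,7,5,6],
   [1,10,0,11,3,7,6,4,9,2,8,5],[2,10,1,11,0,7,5,4,8,3,9,6],[3,11,0,10,1,7,2,9,6,8,4,5],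
   [4,10,0,11,2,9,1,5,7,8,3,6],[7,2,10,6,4,3,9,0,11,1,8,5],[8,0,11,1,10,4,9,2,5,3,7,6],
   [9,2,8,6,1,10,0,11,3,7,4,5],[10,0,11,2,9,1,7,4,8,3,5,6],[11,0,10,1,9,2,8,3,7,4,6,5],
   [0,12,1,11,2,10,3,9,4,8,5,7,6],[1,10,3,11,0,12,2,8,4,9,6,5,7],[2,10,5,9,3,12,0,11,1,8,7,4,6],
   [3,8,4,6,5,11,2,9,1,12,0,10,7],[4,7,5,9,8,2,11,3,10,0,12,1,6],[5,10,3,12,0,11,1,9,8,2,6,4,7],
   [8,7,4,11,1,12,0,9,3,5,10,2,6],[9,2,10,1,11,0,12,6,5,3,8,4,7],[10,2,8,1,11,0,12,3,7,5,4,9,6],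
   [11,0,12,2,10,1,8,3,9,5,6,4,7],[12,0,11,1,10,2,9,3,8,4,7,5,6],[0,13,1,12,2,11,3,10,4,9,5,8,6,7],
   [1,11,4,10,2,13,0,12,3,8,5,9,7,6],[2,13,0,12,3,10,5,11,1,9,6,4,8,7],[3,9,1,13,0,11,2,12,5,10,8,4,7,6],
   [4,5,8,0,13,1,12,2,11,6,10,3,9,7],[5,2,9,7,8,4,10,1,12,0,13,3,11,6],[6,8,3,4,13,0,12,1,11,5,9,2,10,7],
   [7,8,4,2,11,1,12,0,13,5,10,3,9,6],[8,6,10,5,12,0,13,2,11,1,9,3,4,7],[9,8,1,11,2,13,0,12,4,10,5,7,3,6],
   [10,0,13,1,12,4,5,8,6,11,2,9,3,7],[11,1,12,0,13,4,8,3,9,2,10,7,5,6],[12,1,13,0,10,3,11,2,8,4,9,6,5,7],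
   [13,0,12,1,11,2,10,3,9,4,8,5,7,6],[0,14,1,13,2,12,3,11,4,10,5,9,6,8,7],
   [1,12,2,14,0,13,4,10,3,11,6,9,5,7,8],[2,14,0,13,3,11,4,9,5,8,10,1,12,6,7],
   [3,9,1,14,0,12,2,13,4,11,7,10,5,6,8],[4,13,2,12,0,14,1,9,3,10,5,6,8,11,7],
   [5,12,4,10,0,14,1,13,2,11,9,6,7,3,8],[6,2,13,1,14,0,10,4,9,8,11,3,12,5,7],
   [7,5,9,10,1,12,4,11,6,3,13,0,14,2,8],[8,3,12,1,11,9,2,14,0,13,5,6,10,4,7],
   [9,3,13,0,14,2,11,4,12,1,5,10,7,6,8],[10,0,14,1,13,2,9,6,8,4,5,11,3,12,7],
   [11,5,6,10,1,12,4,7,9,2,14,0,13,3,8],[12,0,14,1,11,2,13,5,6,8,4,9,3,10,7],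
   [13,2,12,0,14,1,10,3,11,5,7,6,9,4,8],[14,0,13,1,12,2,11,3,10,4,9,5,8,6,7],
   [0,15,1,14,2,13,3,12,4,11,5,10,6,9,7,8],[1,15,0,13,2,14,4,10,6,11,3,12,5,8,9,7],
   [2,15,0,14,3,13,1,10,6,7,9,4,12,5,11,8],[3,9,5,12,1,13,4,14,0,15,2,10,8,11,6,7],
   [4,12,1,14,0,15,3,13,9,2,11,5,10,7,6,8],[5,10,12,1,15,0,13,6,9,3,11,2,14,4,8,7],
   [6,13,1,14,0,15,4,7,9,5,10,11,3,12,2,8],[9,12,3,8,6,5,13,2,14,1,15,0,10,4,11,7],
   [10,9,0,15,1,14,2,13,3,7,4,12,5,11,6,8],[11,3,14,0,15,2,12,6,13,1,10,9,4,8,5,7],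
   [12,0,15,1,14,3,13,4,10,2,9,5,7,6,11,8],[13,4,11,6,10,2,12,0,15,1,14,3,9,8,5,7],
   [14,0,15,2,13,1,11,5,9,4,12,3,10,7,6,8],[15,0,14,1,13,2,12,3,11,4,10,5,9,6,8,7],
   [0,16,1,15,2,14,3,13,4,12,5,11,6,10,7,9,8],[1,16,0,14,3,15,2,12,6,10,5,13,4,11,8,7,9],
   [2,16,0,15,5,11,9,6,10,3,14,1,13,4,12,7,8],[3,12,6,7,15,0,16,2,13,1,14,4,11,8,10,5,9],
   [4,14,3,16,0,15,1,13,5,12,7,9,6,10,11,2,8],[5,13,8,6,7,11,4,10,1,15,0,16,3,14,2,12,9],
   [6,14,5,10,7,9,3,13,2,15,1,16,0,12,11,4,8],[7,2,11,5,12,4,16,0,15,1,14,3,13,10,6,8,9],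
   [10,2,11,4,16,0,15,1,14,3,13,9,7,12,6,5,8],[11,3,10,5,15,2,14,0,16,1,12,8,7,13,4,6,9],
   [12,3,9,10,7,5,15,1,16,0,13,2,14,6,11,4,8],[13,5,15,2,14,0,16,1,12,3,10,4,7,11,6,8,9],
   [14,1,11,3,15,0,16,2,13,4,9,5,12,6,7,10,8],[15,2,12,3,14,0,16,1,13,5,10,4,11,7,8,6,9],
   [16,0,15,1,14,2,13,3,12,4,11,5,10,6,9,7,8],[0,17,1,16,2,15,3,14,4,13,5,12,6,11,7,10,8,9],
   [1,16,0,17,3,15,2,13,4,14,6,10,7,12,5,11,9,8],[2,16,3,15,0,17,1,12,5,13,4,14,8,7,10,6,11,9],
   [3,16,2,14,6,13,4,10,5,15,0,17,1,12,9,11,7,8],[4,11,7,10,12,6,15,0,17,1,14,2,16,5,13,3,8,9],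
   [5,9,10,13,3,11,2,16,4,15,0,17,1,14,7,12,6,8],[6,16,0,17,2,14,1,15,4,7,13,8,10,11,3,12,5,9],
   [7,10,9,11,5,13,6,1,15,4,14,2,17,0,16,3,12,8],[8,7,4,10,14,3,12,0,17,1,16,2,15,5,13,6,11,9],
   [9,11,6,13,5,17,0,16,1,15,2,12,3,14,10,4,7,8],[10,5,16,0,17,2,14,1,15,7,13,3,12,11,4,8,6,9],
   [11,3,17,0,16,1,14,2,7,13,4,15,5,12,9,10,6,8],[12,5,13,7,6,10,1,17,0,15,2,16,4,14,3,8,11,9],
   [13,6,10,4,14,3,11,2,15,1,16,0,17,5,7,12,9,8],[14,3,8,6,13,4,12,0,17,1,16,2,15,5,11,7,10,9],
   [15,5,10,3,14,2,16,1,17,0,13,4,12,6,9,11,7,8],[16,2,15,0,17,1,13,3,14,5,12,4,10,7,11,6,8,9],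
   [17,0,16,1,15,2,14,3,13,4,12,5,11,6,10,7,9,8],[0,18,1,17,2,16,3,15,4,14,5,13,6,12,7,11,8,10,9],
   [1,18,0,16,3,17,2,14,4,15,6,13,5,11,8,12,7,9,10],[2,15,3,14,8,12,5,13,4,18,0,17,1,16,6,11,10,7,9],
   [3,17,0,18,2,15,5,13,4,16,1,12,8,14,7,9,6,11,10],[4,15,0,18,1,17,3,16,6,12,11,7,10,8,13,5,14,2,9],
   [5,15,4,13,1,18,0,16,3,17,2,9,11,8,7,12,6,14,10],[6,10,5,17,2,16,0,18,1,14,7,8,11,13,3,12,4,15,9],
   [7,11,12,9,4,16,3,18,0,17,1,15,5,14,6,13,2,8,10],[8,7,11,14,5,13,2,15,0,18,1,17,3,10,12,6,16,4,9],
   [9,14,1,17,0,18,3,15,11,5,12,4,13,2,16,6,8,7,10],[10,7,15,4,14,5,12,11,6,8,2,18,0,17,3,16,1,13,9],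
   [11,4,17,2,14,3,12,6,16,0,18,1,15,7,5,8,13,9,10],[12,3,14,2,16,1,17,0,18,5,15,7,8,6,11,4,10,13,9],
   [13,9,8,11,6,15,7,5,12,2,14,3,16,1,17,0,18,4,10],[14,0,18,1,17,2,15,4,16,6,13,5,8,10,11,7,12,3,9],
   [15,1,18,0,16,3,14,4,13,5,17,2,9,11,8,7,12,6,10],[16,1,15,2,18,0,17,5,13,8,7,10,6,12,3,14,4,11,9],
   [17,2,15,1,18,0,16,4,14,3,12,5,13,7,11,6,9,8,10],[18,0,17,1,16,2,15,3,14,4,13,5,12,6,11,7,10,8,9],
   [0,19,1,18,2,17,3,16,4,15,5,14,6,13,7,12,8,11,9,10],[1,19,0,17,3,18,2,15,4,16,6,13,5,14,8,10,11,7,12,9],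
   [2,14,6,11,8,9,13,7,16,3,17,1,18,0,19,4,15,5,12,10],[3,16,5,14,4,11,6,18,2,17,0,19,1,15,7,13,10,12,8,9],
   [4,14,5,13,6,12,8,11,16,3,15,1,17,2,19,0,18,7,9,10],[5,17,6,15,2,16,0,19,1,18,3,13,7,14,10,8,11,12,4,9],
   [6,13,7,15,5,8,12,3,14,2,17,4,18,1,19,0,16,11,9,10],[7,14,11,10,2,17,5,15,4,18,1,19,0,16,3,12,6,8,13,9],
   [8,16,2,18,3,15,9,13,4,14,1,19,0,17,6,11,12,5,7,10],[11,4,15,3,13,14,6,12,8,17,2,16,0,19,1,18,5,10,7,9],
   [12,9,16,4,14,3,8,6,15,1,19,0,17,2,18,5,13,7,11,10],[13,5,14,2,8,15,4,19,0,18,1,17,3,16,6,10,7,12,11,9],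
   [14,3,16,2,12,7,15,11,5,17,1,18,0,19,4,13,6,9,8,10],[15,4,16,6,12,8,3,17,2,18,1,19,0,13,5,14,7,10,11,9],
   [16,4,15,1,19,0,17,2,18,5,13,3,12,8,14,7,9,6,11,10],[17,1,16,3,13,5,11,6,15,4,18,0,19,2,14,7,10,12,8,9],
   [18,2,17,0,19,1,15,3,16,5,12,8,11,6,14,4,13,7,9,10],[19,0,18,1,17,2,16,3,15,4,14,5,13,6,12,7,11,8,10,9]]"

definition long_seeds :: "int list list" where
"long_seeds =
  [[1,5,0,6,3,2,4],[6,2,3,5,0,7,1,4],[2,7,3,5,6,0,8,1,4],[7,1,5,6,3,8,0,9,2,4],[2,8,4,3,6,1,9,0,7,5],
   [3,8,7,4,6,2,9,1,10,0,11,5],[3,14,0,13,1,9,4,10,6,7,5,12,2,11,8],[12,1,14,0,15,3,13,7,9,6,5,10,2,11,4,8],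
   [4,14,0,16,1,9,5,12,3,15,2,13,7,10,11,6,8],[13,1,15,4,10,3,16,0,17,2,12,7,6,14,5,9,11,8],
   [4,12,6,13,3,14,2,15,1,16,0,17,8,5,10,11,7,9],[5,16,3,18,0,19,2,14,10,7,17,1,15,6,12,4,11,13,8,9],
   [5,21,2,16,7,19,1,22,0,20,3,18,8,11,4,17,6,14,13,9,15,10,12],
   [18,6,11,14,10,8,15,9,20,3,16,7,17,1,23,0,21,2,22,4,19,5,13,12],
   [6,18,5,20,4,24,0,23,1,22,3,21,7,16,10,11,14,9,17,13,15,8,19,2,12],
   [19,7,20,6,23,5,21,0,25,1,24,2,22,3,18,8,17,9,15,4,11,16,14,10,13,12],
   [6,24,0,25,2,23,1,21,12,10,20,5,22,3,19,7,18,4,17,9,16,15,11,14,8,13],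
   [7,24,3,23,9,18,8,21,5,20,15,14,11,19,12,10,16,4,22,0,27,1,26,2,25,6,17,13],
   [7,26,2,29,3,28,0,30,1,24,4,25,8,22,10,18,13,23,17,14,12,19,6,21,5,27,9,20,11,15,16],
   [24,7,25,6,26,3,31,0,30,1,28,2,27,5,29,8,23,9,21,10,20,4,17,14,15,13,22,18,12,19,11,16],
   [8,26,7,27,10,24,11,14,19,18,9,21,6,30,5,28,2,29,0,32,1,31,3,25,4,20,12,23,13,17,15,22,16],
   [25,9,18,23,12,19,17,14,20,10,22,4,27,8,28,6,30,5,31,1,29,2,33,0,32,3,24,7,21,13,26,11,15,16],
   [8,27,4,28,2,31,6,26,5,21,9,20,11,24,10,25,7,29,1,32,0,33,3,30,13,18,16,22,12,19,23,15,14,17],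
   [9,15,23,13,26,12,24,6,28,1,34,0,35,3,31,5,29,8,25,14,21,16,18,22,7,32,2,33,4,27,11,30,10,19,20,17],
   [9,29,7,26,12,23,22,17,32,11,28,10,35,2,37,3,34,4,36,0,38,1,30,6,33,5,31,8,24,16,25,15,27,14,18,21,19,13,20],
   [30,11,25,12,27,15,14,22,13,24,19,35,6,38,1,39,0,36,2,37,4,34,3,31,5,32,8,33,10,28,7,29,9,26,16,23,17,21,18,20],
   [10,29,9,34,16,24,17,26,11,32,8,31,15,28,14,18,21,23,12,22,27,5,39,2,37,1,40,0,38,7,35,6,33,3,36,4,30,13,25,19,20],
   [31,8,38,11,23,17,25,18,15,24,19,21,22,26,16,33,12,34,5,40,0,41,2,39,1,37,3,36,4,35,7,32,6,30,10,29,13,28,14,27,9,20]]"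

section \<open>Verification of the tables by evaluation\<close>

definition good_seed :: "int list \<Rightarrow> bool" where
  "good_seed s \<longleftrightarrow> s \<noteq> [] \<and> graceful s \<and> near_middle (int (length s)) (last s)"

lemma good_seed_code [code]:
  "good_seed s \<longleftrightarrow> s \<noteq> [] \<and> distinct s \<and> list_all (\<lambda>x. 0 \<le> x \<and> x < int (length s)) s \<and>
    distinct (steps (\<lambda>x y. \<bar>y - x\<bar>) s) \<and> near_middle (int (length s)) (last s)"
  by (auto simp: good_seed_def graceful_def list_all_iff)

lemma seeds_good: "list_all good_seed seeds"
  by code_simp

lemma long_seeds_good: "list_all good_seed long_seeds"
  by code_simp

text \<open>The table is listed in the order of the comprehension, so coverage becomes a single
  equality of lists.\<close>

lemma seeds_cover: "map (\<lambda>s. (int (length s), hd s)) seeds =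
    [(r, v). r \<leftarrow> [1..20], v \<leftarrow> [0..r - 1], \<not> exceptional r v]"
  by code_simp

text \<open>The parity condition comes from 2l = pq + r, where an even \<open>p\<close> forces an
  even \<open>r\<close>.\<close>

lemma long_seeds_cover: "map (\<lambda>s. (int (length s), hd s)) long_seeds =
    [(int (r + p), zigzag_start (int (r + p)) p). r \<leftarrow> [1..<21], p \<leftarrow> [1..<2 * r + 1],
      (even p \<longrightarrow> even r) \<and> exceptional (int r) (zigzag_start (int r) p)]"
  by code_simp

lemma mem_comprehension:
  "r \<in> set A \<Longrightarrow> p \<in> set (B r) \<Longrightarrow> C r p \<Longrightarrow> F r p \<in> set [F r p. r \<leftarrow> A, p \<leftarrow> B r, C r p]"
  by (simp, blast)

lemma twizzled_seed:
  assumes r: "1 \<le> r" "r \<le> 20" and p: "1 \<le> p" "p \<le> 2 * r" and par: "even p \<longrightarrow> even r"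
  shows "\<exists>s. twizzled p s \<and>
    length s = (if exceptional (int r) (zigzag_start (int r) p) then r + p else r)"
proof (cases "exceptional (int r) (zigzag_start (int r) p)")
  case False
  have v: "0 \<le> zigzag_start (int r) p" "zigzag_start (int r) p \<le> int r - 1"
    using p by (auto simp: zigzag_start_def elim!: evenE oddE)
  have "(int r, zigzag_start (int r) p) \<in> set (map (\<lambda>s. (int (length s), hd s)) seeds)"
    unfolding seeds_cover using r v False by auto
  then obtain s where "s \<in> set seeds" "int (length s) = int r" "hd s = zigzag_start (int r) p"
    by auto
  then show ?thesis
    using False seeds_good by (auto simp: twizzled_def good_seed_def list_all_iff)
next
  case True
  have "(int (r + p), zigzag_start (int (r + p)) p)
      \<in> set (map (\<lambda>s. (int (length s), hd s)) long_seeds)"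
    unfolding long_seeds_cover by (rule mem_comprehension) (use r p par True in auto)
  then obtain s where "s \<in> set long_seeds" "int (length s) = int (r + p)"
      "hd s = zigzag_start (int (r + p)) p"
    by auto
  then show ?thesis
    using True long_seeds_good by (auto simp: twizzled_def good_seed_def list_all_iff simp del: of_nat_add)
qed

text \<open>The first gap is that of the block attached last. For \<open>p = 1\<close> this block is
  a single entry and the first gap is the joining gap, one less than the formula.\<close>

lemma twizzled_iterate:
  assumes "twizzled p s" and "p > 0" and "q > 0"
  shows "\<exists>xs. twizzled p xs \<and> length xs = length s + p * q \<and>
    (p > 1 \<longrightarrow> \<bar>xs ! 1 - xs ! 0\<bar> = int (length xs) + 1 - int p)"
  using assms(3)
proof (induction q rule: nat_induct_non_zero)
  case 1
  show ?case
    using twizzled_twist[OF assms(1,2)] twist_first_gap[of p s] by (intro exI[of _ "twist p s"]) simp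
next
  case (Suc q)
  then obtain xs where "twizzled p xs" "length xs = length s + p * q" by blast
  then show ?case
    using twizzled_twist[of p xs] twist_first_gap[of p xs] assms(2)
    by (intro exI[of _ "twist p xs"]) simp
qed

section \<open>Sequencings from graceful orderings\<close>

text \<open>A cross step between the rotation $u^i$ and the reflection $u^{-j}v$ is labelled $-(i+j)$, so
  along these alternating paths the labels are consecutive integers.\<close>

fun descend :: "nat \<Rightarrow> (int \<times> bool) list" where
  "descend 0 = [(0, False)]"
| "descend (Suc k) = (int k + 1, False) # (- int k, True) # descend k"

text \<open>Rotations stay above \<open>n\<close> and reflections at or below \<open>- n\<close>,
  which avoids the vertices of \<open>descend n\<close>. The sums i + j fall from 2(n + k) to 2n +
  1.\<close>

fun ascend :: "nat \<Rightarrow> nat \<Rightarrow> (int \<times> bool) list" where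
  "ascend n 0 = [(- int n, True)]"
| "ascend n (Suc k) = (- int (n + k + 1), True) # (int (n + k + 1), False) # ascend n k"

lemma descend_nonempty [simp]: "descend k \<noteq> []" by (cases k) auto

lemma ascend_nonempty [simp]: "ascend n k \<noteq> []" by (cases k) auto

lemma hd_descend: "hd (descend k) = (int k, False)" by (cases k) auto

lemma last_descend: "last (descend k) = (0, False)" by (induction k) auto

lemma hd_ascend: "hd (ascend n k) = (- int (n + k), True)" by (cases k) auto

lemma last_ascend: "last (ascend n k) = (- int n, True)" by (induction k) auto

lemma length_descend [simp]: "length (descend k) = 2 * k + 1" by (induction k) auto

lemma length_ascend [simp]: "length (ascend n k) = 2 * k + 1" by (induction k) auto

lemma mem_descend:
  "(i, b) \<in> set (descend k) \<longleftrightarrow> (if b then - int k < i \<and> i \<le> 0 else 0 \<le> i \<and> i \<le> int k)"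
  by (induction k) (simp, cases b, simp, linarith, simp, linarith)

lemma mem_ascend:
  "(i, b) \<in> set (ascend n k) \<longleftrightarrow>
    (if b then - int (n + k) \<le> i \<and> i \<le> - int n else int n < i \<and> i \<le> int (n + k))"
proof (induction k)
  case 0
  show ?case by (cases b) auto
next
  case (Suc k)
  then show ?case by (cases b) (simp, linarith, simp, linarith)
qed

lemma distinct_descend: "distinct (descend k)"
  by (induction k) (simp_all add: mem_descend)

lemma distinct_ascend: "distinct (ascend n k)"
  by (induction k) (simp_all add: mem_ascend)

lemma steps_descend: "steps lab (descend k) = map (\<lambda>s. (- int s, True)) (rev [0..<2 * k])"
proof (induction k)
  case (Suc k)
  have "steps lab (descend (Suc k)) =
      (- 2 * int k - 1, True) # (- 2 * int k, True) # steps lab (descend k)"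
    by (cases k) (auto simp: lab_def)
  then show ?case by (simp add: Suc)
qed simp

lemma steps_ascend:
  "steps lab (ascend n k) = map (\<lambda>s. (- int s, True)) (rev [2 * n + 1..<2 * n + 2 * k + 1])"
proof (induction k)
  case (Suc k)
  have "steps lab (ascend n (Suc k)) =
      (- 2 * int (n + k + 1), True) # (- 2 * int (n + k) - 1, True) # steps lab (ascend n k)"
    by (cases k) (auto simp: lab_def)
  then show ?case by (simp add: Suc)
qed simp

text \<open>Since absolute values are distinct and nonzero, no difference is the negative of another
  one. This separates the labels of an ordering from those of its copy among the
  reflections.\<close>

lemma graceful_differences:
  assumes "graceful xs"
  defines "D \<equiv> steps (\<lambda>x y. y - x) xs"
  shows "distinct D" and "set D \<inter> uminus ` set D = {}"
    and "\<And>d. d \<in> set D \<Longrightarrow> d \<noteq> 0 \<and> \<bar>d\<bar> < int (length xs)"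
proof -
  have abs: "map abs D = steps (\<lambda>x y. \<bar>y - x\<bar>) xs"
    by (simp add: D_def map_steps)
  then have d: "distinct (map abs D)"
    using assms(1) by (simp add: graceful_def)
  then show "distinct D" by (simp add: distinct_map)
  show nz: "d \<noteq> 0 \<and> \<bar>d\<bar> < int (length xs)" if "d \<in> set D" for d
  proof -
    have "\<bar>d\<bar> \<in> set (steps (\<lambda>x y. \<bar>y - x\<bar>) xs)"
      using that abs by (metis image_eqI list.set_map)
    then show ?thesis using graceful_gap[OF assms(1)] by fastforce
  qed
  show "set D \<inter> uminus ` set D = {}"
  proof (rule ccontr)
    assume "set D \<inter> uminus ` set D \<noteq> {}"
    then obtain d where "d \<in> set D" "- d \<in> set D" by auto
    then have "d = - d"
      using d inj_onD[of abs "set D" d "- d"] by (simp add: distinct_map)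
    then show False using nz[OF \<open>d \<in> set D\<close>] by simp
  qed
qed

lemma steps_rotations:
  "steps lab (map (\<lambda>x. (x + k, False)) xs) = map (\<lambda>d. (d, False)) (steps (\<lambda>x y. y - x) xs)"
  by (simp add: steps_map map_steps lab_def)

text \<open>There are three sign changes, from \<open>k - x\<close>, from \<open>lab\<close> on
  reflections and from the reversal; the net effect is one.\<close>

lemma steps_reflections:
  "steps lab (map (\<lambda>x. (k - x, True)) (rev xs)) =
    map (\<lambda>d. (- d, False)) (rev (steps (\<lambda>x y. y - x) xs))"
  by (simp add: steps_map map_steps lab_def steps_rev flip: rev_map)

lemma sequencing_from_graceful:
  assumes g: "graceful xs" and len: "length xs = 2 * l" and l: "l > 0"
    and last: "last xs = int l" and c: "coprime c (int (4 * l + 1))"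
  shows "has_S_sequencing (dihedral (4 * l + 1)) (carrier (dihedral (4 * l + 1)) -
    {\<one>\<^bsub>dihedral (4 * l + 1)\<^esub>, red c (4 * l + 1) (xs ! 1 - xs ! 0, False)})"
proof -
  let ?N = "2 * int l"
  define D where "D = steps (\<lambda>x y. y - x) xs"
  obtain x y zs where xs: "xs = x # y # zs"
  proof -
    have "Suc (Suc 0) \<le> length xs" using len l by simp
    then show ?thesis using that by (auto simp: Suc_le_length_iff)
  qed
  define D' where "D' = steps (\<lambda>x y. y - x) (y # zs)"
  have D: "D = (y - x) # D'" by (simp add: D_def D'_def xs)
  note dist = graceful_differences[OF g, folded D_def]
  \<comment> \<open>Dropping the first vertex loses the label \<open>y - x\<close>, while its
    negative still occurs in \<open>Z\<close>.\<close>
  define W where "W = map (\<lambda>x. (x + (- ?N), False)) (y # zs)"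
  define Z where "Z = map (\<lambda>x. (?N - x, True)) (rev xs)"
  define vs where "vs = W @ descend l @ ascend l l @ Z"
  have range: "distinct xs" "set xs \<subseteq> {0..<?N}"
    using g len by (auto simp: graceful_def)
  have sW: "set W \<subseteq> {- ?N..<0} \<times> {False}" and dW: "distinct W"
    using range by (auto simp: W_def xs distinct_map inj_on_def)
  have sZ: "set Z \<subseteq> {1..?N} \<times> {True}" and dZ: "distinct Z"
    using range by (auto simp: Z_def distinct_map inj_on_def)
  have "last W = (- int l, False)"
    using last by (simp add: W_def xs last_map del: list.map)
  moreover have "hd Z = (int l, True)"
    using last by (simp add: Z_def hd_map hd_rev xs del: rev.simps)
  moreover have "W \<noteq> []" "Z \<noteq> []" by (simp_all add: W_def Z_def xs)
  moreover have "steps lab W = map (\<lambda>d. (d, False)) D'"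
    unfolding W_def D'_def by (rule steps_rotations)
  moreover have "steps lab Z = map (\<lambda>d. (- d, False)) (rev D)"
    unfolding Z_def D_def by (rule steps_reflections)
  \<comment> \<open>The jump from \<open>(0, False)\<close> to \<open>(- ?N, True)\<close> supplies
    the one sum i + j that the two alternating paths leave out.\<close>
  ultimately have L: "steps lab vs = map (\<lambda>d. (d, False)) D' @ (?N, False) #
      map (\<lambda>s. (- int s, True)) (rev [0..<2 * l]) @ (- ?N, True) #
      map (\<lambda>s. (- int s, True)) (rev [2 * l + 1..<4 * l + 1]) @ (- ?N, False) #
      map (\<lambda>d. (- d, False)) (rev D)"
    unfolding vs_def
    by (simp add: steps_append steps_descend steps_ascend hd_append hd_descend last_descend hd_ascend
        last_ascend lab_def)
  have bound: "d \<noteq> 0" "\<bar>d\<bar> < ?N" if "d \<in> set D" for d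
    using dist(3)[OF that] len by auto
  have sL: "set (steps lab vs) \<subseteq>
      (set D' \<union> {?N, - ?N} \<union> uminus ` set D) \<times> {False} \<union> {- 2 * ?N..0} \<times> {True}"
    unfolding L by auto
  have "?N \<notin> set D" "- ?N \<notin> set D" using bound(2)[of ?N] bound(2)[of "- ?N"] by auto
  moreover have D': "distinct D'" "set D' \<subseteq> set D" using dist(1) by (auto simp: D)
  ultimately have dL: "distinct (steps lab vs)"
    unfolding L using dist(1,2) l
    by (auto simp: distinct_map inj_on_def)
  have new: "y - x \<notin> set D' \<union> {?N, - ?N} \<union> uminus ` set D" "0 \<notin> set D' \<union> {?N, - ?N} \<union> uminus ` set D"
    using dist(1,2) bound[of "y - x"] bound(1)[of 0] l by (auto simp: D)
  have win: "(set D' \<union> {?N, - ?N} \<union> uminus ` set D) \<times> {False} \<union> {- 2 * ?N..0} \<times> {True}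
      \<subseteq> window (4 * l + 1) (- ?N) (- 2 * ?N)"
  proof -
    have "- ?N \<le> d \<and> d \<le> ?N" if "d \<in> set D" for d
      using bound(2)[OF that] by linarith
    then have "set D \<subseteq> {- ?N..?N}" "uminus ` set D \<subseteq> {- ?N..?N}"
      by force+
    then show ?thesis using D'(2) by (auto simp: window_def)
  qed
  have "has_S_sequencing (dihedral (4 * l + 1)) (carrier (dihedral (4 * l + 1)) -
    {\<one>\<^bsub>dihedral (4 * l + 1)\<^esub>, red c (4 * l + 1) (y - x, False)})"
  \<comment> \<open>Vertices of both kinds lie between -N and N; the labels that are reflections lie
    between -2N and 0. Each range has 4l + 1 integers.\<close>
  proof (rule sequencing_of_path[where vs = vs and a = "- ?N" and b = "- ?N" and a' = "- ?N" and b' = "- 2 * ?N"])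
    show "distinct vs"
      unfolding vs_def using dW dZ distinct_descend distinct_ascend sW sZ
      by (auto simp: mem_descend mem_ascend split: if_splits)
    show "set vs \<subseteq> window (4 * l + 1) (- ?N) (- ?N)"
      using sW sZ by (auto simp: vs_def window_def mem_descend mem_ascend split: if_splits)
    show "length vs = 2 * (4 * l + 1) - 1"
      using len by (simp add: vs_def W_def Z_def xs)
    show "set (steps lab vs) \<subseteq> window (4 * l + 1) (- ?N) (- 2 * ?N)"
      using sL win by (rule subset_trans)
    show "(0, False) \<notin> set (steps lab vs)" "(y - x, False) \<notin> set (steps lab vs)"
      using new sL by blast+
    show "(y - x, False) \<in> window (4 * l + 1) (- ?N) (- 2 * ?N)" "y - x \<noteq> 0"
      using bound[of "y - x"] by (auto simp: D window_def)
    show "(0, False) \<in> window (4 * l + 1) (- ?N) (- 2 * ?N)"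
      by (simp add: window_def)
  qed (use c dL in simp_all)
  then show ?thesis by (simp add: xs)
qed

text \<open>The degenerate case, where the missing rotation is $u^{\pm 2l}$: the single jump from the
  rotations' alternating path to the remaining rotations uses one of its two signs.\<close>

lemma sequencing_from_graceful_0:
  assumes g: "graceful xs" and len: "length xs = 2 * l" and l: "l > 0"
    and hd: "hd xs = 0" and c: "coprime c (int (4 * l + 1))"
  shows "has_S_sequencing (dihedral (4 * l + 1)) (carrier (dihedral (4 * l + 1)) -
    {\<one>\<^bsub>dihedral (4 * l + 1)\<^esub>, red c (4 * l + 1) (2 * int l, False)})"
proof -
  let ?N = "2 * int l"
  define D where "D = steps (\<lambda>x y. y - x) xs"
  obtain y zs where xs: "xs = 0 # y # zs"
  proof -
    have "Suc (Suc 0) \<le> length xs" using len l by simp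
    then show ?thesis using that hd by (auto simp: Suc_le_length_iff)
  qed
  define D' where "D' = steps (\<lambda>x y. y - x) (y # zs)"
  have D: "D = y # D'" by (simp add: D_def D'_def xs)
  note dist = graceful_differences[OF g, folded D_def]
  define W where "W = map (\<lambda>x. (x + (- ?N), False)) xs"
  \<comment> \<open>The entry 0 is left out because its image \<open>(- ?N, True)\<close> is already
    the first vertex of \<open>ascend 0 (2 * l)\<close>; the step into that vertex has label
    \<open>- y\<close>.\<close>
  define Z where "Z = map (\<lambda>x. (- ?N - x, True)) (rev (y # zs))"
  define vs where "vs = Z @ ascend 0 (2 * l) @ (0, False) # W"
  have range: "distinct xs" "set xs \<subseteq> {0..<?N}"
    using g len by (auto simp: graceful_def)
  have sW: "set W \<subseteq> {- ?N..<0} \<times> {False}" and dW: "distinct W"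
    using range by (auto simp: W_def distinct_map inj_on_def)
  have "z \<noteq> 0" "z \<in> {0..<?N}" if "z \<in> set (y # zs)" for z
    using range that by (auto simp: xs)
  then have "set (y # zs) \<subseteq> {0<..<?N}" by force
  moreover have "distinct (y # zs)" using range by (simp add: xs)
  ultimately have sZ: "set Z \<subseteq> {- 2 * ?N<..<- ?N} \<times> {True}" and dZ: "distinct Z"
    by (auto simp: Z_def distinct_map inj_on_def)
  have "hd W = (- ?N, False)" by (simp add: W_def xs)
  moreover have "last Z = (- ?N - y, True)" by (simp add: Z_def)
  moreover have "W \<noteq> []" "Z \<noteq> []" by (simp_all add: W_def Z_def xs)
  moreover have "steps lab W = map (\<lambda>d. (d, False)) D"
    unfolding W_def D_def by (rule steps_rotations)
  moreover have "steps lab Z = map (\<lambda>d. (- d, False)) (rev D')"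
    unfolding Z_def D'_def by (rule steps_reflections)
  moreover have "steps lab ((0, False) # W) = (- ?N, False) # map (\<lambda>d. (d, False)) D"
    using calculation by (cases W) (auto simp: lab_def)
  ultimately have L: "steps lab vs = map (\<lambda>d. (- d, False)) (rev D') @ (- y, False) #
      map (\<lambda>s. (- int s, True)) (rev [1..<4 * l + 1]) @ (0, True) # (- ?N, False) #
      map (\<lambda>d. (d, False)) D"
    unfolding vs_def
    by (simp add: steps_append steps_ascend hd_append hd_ascend last_ascend lab_def del: steps_simps)
  have bound: "d \<noteq> 0" "\<bar>d\<bar> < ?N" if "d \<in> set D" for d
    using dist(3)[OF that] len by auto
  have sL: "set (steps lab vs) \<subseteq>
      (set D \<union> {- ?N} \<union> uminus ` set D) \<times> {False} \<union> {- 2 * ?N..0} \<times> {True}"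
    unfolding L by (auto simp: D)
  have D': "distinct D'" "set D' \<subseteq> set D" "y \<in> set D" "y \<notin> set D'" using dist(1) by (auto simp: D)
  moreover have "?N \<notin> set D" "- ?N \<notin> set D" using bound(2)[of ?N] bound(2)[of "- ?N"] by auto
  ultimately have dL: "distinct (steps lab vs)"
    unfolding L using dist(1,2) l
    by (auto simp: distinct_map inj_on_def)
  have new: "?N \<notin> set D \<union> {- ?N} \<union> uminus ` set D" "0 \<notin> set D \<union> {- ?N} \<union> uminus ` set D"
    using bound[of ?N] bound(2)[of "- ?N"] bound(1)[of 0] l by auto
  have win: "(set D \<union> {- ?N} \<union> uminus ` set D) \<times> {False} \<union> {- 2 * ?N..0} \<times> {True}
      \<subseteq> window (4 * l + 1) (- ?N) (- 2 * ?N)"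
  proof -
    have "- ?N \<le> d \<and> d \<le> ?N" if "d \<in> set D" for d
      using bound(2)[OF that] by linarith
    then have "set D \<subseteq> {- ?N..?N}" "uminus ` set D \<subseteq> {- ?N..?N}"
      by force+
    then show ?thesis by (auto simp: window_def)
  qed
  show ?thesis
  proof (rule sequencing_of_path[where vs = vs and a = "- ?N" and b = "- 2 * ?N" and a' = "- ?N" and b' = "- 2 * ?N"])
    show "distinct vs"
      unfolding vs_def using dW dZ distinct_ascend sW sZ
      by (auto simp: mem_ascend split: if_splits)
    show "set vs \<subseteq> window (4 * l + 1) (- ?N) (- 2 * ?N)"
      using sW sZ by (auto simp: vs_def window_def mem_ascend split: if_splits)
    show "length vs = 2 * (4 * l + 1) - 1"
      using len by (simp add: vs_def W_def Z_def xs)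
    show "set (steps lab vs) \<subseteq> window (4 * l + 1) (- ?N) (- 2 * ?N)"
      using sL win by (rule subset_trans)
    show "(0, False) \<notin> set (steps lab vs)" "(?N, False) \<notin> set (steps lab vs)"
      using new sL by blast+
    show "(?N, False) \<in> window (4 * l + 1) (- ?N) (- 2 * ?N)" "?N \<noteq> 0"
      using l by (auto simp: window_def)
    show "(0, False) \<in> window (4 * l + 1) (- ?N) (- 2 * ?N)"
      by (simp add: window_def)
  qed (use c dL in simp_all)
qed

section \<open>Orders of rotations\<close>

text \<open>With \<open>k\<close> the product of the primes of \<open>m\<close> not dividing
  \<open>c\<close>, each prime of \<open>m\<close> divides exactly one of \<open>c\<close> and
  \<open>n * k\<close>. This lifts units modulo a divisor \<open>n\<close> of \<open>m\<close> to
  units modulo \<open>m\<close>.\<close>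

lemma coprime_lift:
  fixes c n m :: int
  assumes "coprime c n" and "m > 0"
  shows "\<exists>k. coprime (c + n * k) m"
proof
  define k where "k = \<Prod>{p \<in> prime_factors m. \<not> p dvd c}"
  show "coprime (c + n * k) m"
  proof (rule ccontr)
    assume "\<not> coprime (c + n * k) m"
    then have "\<not> is_unit (gcd (c + n * k) m)" using is_unit_gcd by blast
    moreover have "gcd (c + n * k) m \<noteq> 0" using assms(2) by simp
    ultimately obtain p where "prime p" "p dvd gcd (c + n * k) m"
      using prime_divisor_exists by blast
    then have p: "prime p" "p dvd c + n * k" "p dvd m" by simp_all
    show False
    proof (cases "p dvd c")
      case True
      then have "p dvd n * k" using p(2) by (simp add: dvd_add_right_iff)
      moreover have "\<not> p dvd n"
        using True p(1) assms(1) by (meson coprime_common_divisor not_prime_unit)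
      moreover have "\<not> p dvd k"
      proof
        assume "p dvd k"
        then obtain q where q: "q \<in> prime_factors m" "\<not> q dvd c" "p dvd q"
          using p(1) by (auto simp: k_def prime_dvd_prod_iff)
        then have "p = q" using p(1) by (auto intro: primes_dvd_imp_eq)
        then show False using q(2) True by simp
      qed
      ultimately show False using p(1) prime_dvd_mult_iff by blast
    next
      case False
      have "p \<in> {p \<in> prime_factors m. \<not> p dvd c}"
        using p False assms(2) by (simp add: in_prime_factors_iff)
      then have "p dvd k"
        unfolding k_def by (rule dvd_prodI[where f = "\<lambda>p. p", rotated]) simp
      then have "p dvd c" using p(2) by (simp add: dvd_add_left_iff)
      then show False using False by simp
    qed
  qed
qed

text \<open>After division by the common gcd, \<open>u\<close> inverts \<open>a'\<close> modulo
  \<open>n\<close>; the unit \<open>u * b'\<close> modulo \<open>n\<close> is then lifted to a unit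
  modulo \<open>m\<close>.\<close>

lemma unit_multiple:
  fixes a b m :: int
  assumes eq: "gcd a m = gcd b m" and m: "m > 0"
  shows "\<exists>c. coprime c m \<and> c * a mod m = b mod m"
proof -
  define d where "d = gcd a m"
  have d: "d > 0" using m by (simp add: d_def)
  obtain a' n where a: "a = a' * d" and n: "m = n * d" and an: "coprime a' n"
    using gcd_coprime_exists[of a m] m unfolding d_def by auto
  obtain b' n' where b: "b = b' * d" and n': "m = n' * d" and bn: "coprime b' n'"
    using gcd_coprime_exists[of b m] m unfolding d_def eq by auto
  have nn: "n' = n" using n n' d by simp
  obtain u v where uv: "u * a' + v * n = 1"
    using bezout_int[of a' n] an by auto
  have "coprime u n"
    using uv by (metis coprime_iff_gcd_eq_1 coprimeI dvd_add dvd_mult dvd_mult2)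
  then have "coprime (u * b') n" using bn nn by simp
  then obtain k where k: "coprime (u * b' + n * k) m"
    using coprime_lift m by blast
  have "(u * b' + n * k) * a - b = m * (k * a' - v * b')"
  proof -
    have "(u * b' + n * k) * a - b = (b' * (u * a') + n * k * a' - b') * d"
      by (simp add: a b algebra_simps)
    also have "u * a' = 1 - v * n" using uv by simp
    finally show ?thesis by (simp add: n algebra_simps)
  qed
  then have "m dvd (u * b' + n * k) * a - b" by simp
  then show ?thesis using k by (auto simp: mod_eq_dvd_iff)
qed

section \<open>Orders of elements and greatest common divisors\<close>

lemma rotation_pow:
  "(i, False) [^]\<^bsub>dihedral m\<^esub> (n::nat) = (n * i mod m, False)" if "m > 0" "i < m"
proof (induction n)
  case (Suc n)
  then show ?case
    by (simp add: dihedral_simps nat_pow_def mod_simps add.commute)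
qed (simp add: dihedral_simps nat_pow_def)

lemma ord_rotation_dvd_iff:
  assumes "m > 0" and "i < m"
  shows "group.ord (dihedral m) (i, False) dvd n \<longleftrightarrow> m dvd n * i"
proof -
  interpret group "dihedral m" using assms(1) by (rule group_dihedral)
  have "(i, False) \<in> carrier (dihedral m)" using assms by (simp add: dihedral_simps)
  then have "ord (i, False) dvd n \<longleftrightarrow> (i, False) [^]\<^bsub>dihedral m\<^esub> n = \<one>\<^bsub>dihedral m\<^esub>"
    by (simp add: pow_eq_id)
  then show ?thesis
    using rotation_pow[OF assms, of n] by (auto simp: dihedral_simps)
qed

text \<open>Equal orders mean that the same multiples of \<open>i\<close> and \<open>j\<close>
  vanish modulo \<open>m\<close>. Testing the multiple m / gcd(a, m) shows that each gcd divides the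
  other residue.\<close>

lemma gcd_eq_of_ord_eq:
  fixes i j m :: nat
  assumes m: "m > 0" and "i < m" "j < m"
    and "group.ord (dihedral m) (i, False) = group.ord (dihedral m) (j, False)"
  shows "gcd i m = gcd j m"
proof -
  have iff: "m dvd n * i \<longleftrightarrow> m dvd n * j" for n
    using ord_rotation_dvd_iff[OF m] assms(2-) by metis
  have dvd: "gcd a m dvd b" if *: "\<And>n. m dvd n * a \<longleftrightarrow> m dvd n * b" for a b :: nat
  proof -
    obtain n where n: "m = n * gcd a m" by (metis dvd_div_mult_self gcd_dvd2)
    have "m dvd n * a" by (subst n) (simp add: mult_dvd_mono)
    then have "n * gcd a m dvd n * b" using * n by metis
    then show ?thesis using n m by (metis dvd_times_left_cancel_iff mult_is_0 not_gr0)
  qed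
  have "gcd i m dvd j" "gcd j m dvd i" by (rule dvd; simp add: iff)+
  then show ?thesis by (intro dvd_antisym) simp_all
qed

text \<open>The order of a reflection divides 2, while that of a rotation divides the odd number
  \<open>m\<close>.\<close>

lemma odd_ord_is_rotation:
  assumes m: "m > 0" "odd m" and x: "x \<in> carrier (dihedral m) - {\<one>\<^bsub>dihedral m\<^esub>}"
    and eq: "group.ord (dihedral m) x = group.ord (dihedral m) (j, False)" and "j < m"
  shows "\<not> snd x"
proof
  assume "snd x"
  then obtain i where xi: "x = (i, True)" "i < m"
    using x by (cases x) (auto simp: dihedral_simps)
  interpret group "dihedral m" using m(1) by (rule group_dihedral)
  have "x [^]\<^bsub>dihedral m\<^esub> (2::nat) = \<one>\<^bsub>dihedral m\<^esub>"
    using xi by (simp add: numeral_2_eq_2 nat_pow_def dihedral_simps)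
  then have "ord x dvd 2" using x by (simp add: pow_eq_id)
  moreover have "ord x dvd m"
    unfolding eq using ord_rotation_dvd_iff[OF m(1) \<open>j < m\<close>] by simp
  ultimately have "ord x dvd 1"
    using m(2) by (metis coprime_common_divisor_nat coprime_left_2_iff_odd nat_dvd_1_iff_1)
  then have "x [^]\<^bsub>dihedral m\<^esub> (1::nat) = \<one>\<^bsub>dihedral m\<^esub>"
    using x by (subst pow_eq_id) auto
  then show False using x by simp
qed

section \<open>The missing rotation\<close>

lemma graceful_mirror:
  assumes "graceful xs"
  shows "graceful (map (\<lambda>x. int (length xs) - 1 - x) xs)"
proof -
  have "steps (\<lambda>x y. \<bar>y - x\<bar>) (map (\<lambda>x. int (length xs) - 1 - x) xs) = steps (\<lambda>x y. \<bar>y - x\<bar>) xs"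
    by (simp add: steps_map abs_minus_commute)
  then show ?thesis
    using assms by (auto simp: graceful_def distinct_map inj_on_def)
qed

lemma missing_rotation:
  assumes xs: "twizzled p xs" and len: "length xs = 2 * l" and l: "l > 0"
    and t: "\<bar>xs ! 1 - xs ! 0\<bar> = int t" and i: "i < 4 * l + 1"
    and eq: "gcd i (4 * l + 1) = gcd t (4 * l + 1)"
  shows "has_S_sequencing (dihedral (4 * l + 1)) (carrier (dihedral (4 * l + 1)) -
    {\<one>\<^bsub>dihedral (4 * l + 1)\<^esub>, (i, False)})"
proof -
  let ?m = "4 * l + 1"
  have g: "graceful xs" and e: "last xs = int l \<or> last xs = int l - 1"
    using xs len by (auto simp: twizzled_def near_middle_def)
  obtain ys where ys: "graceful ys" "length ys = 2 * l" "last ys = int l"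
      "\<bar>ys ! 1 - ys ! 0\<bar> = int t"
  \<comment> \<open>The mirror image exchanges the end points l - 1 and l and keeps the
    gaps.\<close>
  proof (cases "last xs = int l")
    case False
    then have "last (map (\<lambda>x. int (length xs) - 1 - x) xs) = int l"
      using e len l by (subst last_map) auto
    then show ?thesis
      using that[of "map (\<lambda>x. int (length xs) - 1 - x) xs"] graceful_mirror[OF g] len l t by simp
  qed (use that g len t in blast)
  have "gcd (ys ! 1 - ys ! 0) (int ?m) = gcd \<bar>ys ! 1 - ys ! 0\<bar> (int ?m)" by simp
  also have "\<dots> = gcd (int i) (int ?m)" unfolding ys(4) by (simp only: gcd_int_int_eq eq)
  finally obtain c where c: "coprime c (int ?m)" "c * (ys ! 1 - ys ! 0) mod int ?m = int i mod int ?m"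
    using unit_multiple[of "ys ! 1 - ys ! 0" "int ?m" "int i"] by auto
  have "red c ?m (ys ! 1 - ys ! 0, False) = (i, False)"
    using c(2) i by (simp add: red_def)
  then show ?thesis
    using sequencing_from_graceful[OF ys(1,2) l ys(3) c(1)] by simp
qed

lemma coprime_mult_add_1: "coprime (a :: nat) (k * a + 1)"
  by (metis coprime_add_one_right coprime_mult_left_iff mult.commute)

text \<open>Since 2l is coprime to 4l + 1, the rotation $u^{2l}$ of the degenerate case is itself a
  generator. The ordering starting at 0 grows from a single entry by twists with
  \<open>p = 1\<close>.\<close>

lemma missing_generator:
  assumes l: "l > 0" and i: "i < 4 * l + 1" and cop: "coprime i (4 * l + 1)"
  shows "has_S_sequencing (dihedral (4 * l + 1)) (carrier (dihedral (4 * l + 1)) -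
    {\<one>\<^bsub>dihedral (4 * l + 1)\<^esub>, (i, False)})"
proof -
  let ?m = "4 * l + 1"
  obtain s where s: "twizzled 1 s" "length s = 1"
    using twizzled_seed[of 1 1] by (auto simp: exceptional_def)
  obtain xs where xs: "twizzled 1 xs" "length xs = 2 * l"
    using twizzled_iterate[OF s(1), of "2 * l - 1"] l s(2) by auto
  have "coprime (int (2 * l)) (int ?m)"
    using coprime_mult_add_1[of "2 * l" 2] by (simp only: coprime_int_iff) simp
  then have "gcd (int (2 * l)) (int ?m) = gcd (int i) (int ?m)"
    using cop by (simp only: coprime_iff_gcd_eq_1 gcd_int_int_eq of_nat_1)
  then obtain c where c: "coprime c (int ?m)" "c * (2 * int l) mod int ?m = int i mod int ?m"
    using unit_multiple[of "int (2 * l)" "int ?m" "int i"] by auto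
  have "red c ?m (2 * int l, False) = (i, False)"
    using c(2) i by (simp add: red_def)
  moreover have "graceful xs" "hd xs = 0"
    using xs by (auto simp: twizzled_def zigzag_start_def)
  ultimately show ?thesis
    using sequencing_from_graceful_0[of xs l c] xs(2) l c(1) by simp
qed

text \<open>Modulo any divisor of 4l + 1, each of l + 1 and 2l - 1 vanishes only if 3 does, and then
  so does the other. This handles p = r = l, where the exponent is l + 1.\<close>

lemma gcd_shift:
  assumes "l > 0"
  shows "gcd (l + 1) (4 * l + 1) = gcd (2 * l - 1) (4 * l + 1 :: nat)"
proof -
  have three: "4 * (l + 1) - (4 * l + 1) = 3" "4 * l + 1 - 2 * (2 * l - 1) = 3"
    "2 * (l + 1) - 3 = 2 * l - 1" "4 * l + 1 - l * 3 = l + 1"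
    using assms by simp_all
  have "d dvd l + 1 \<longleftrightarrow> d dvd 2 * l - 1" if d: "d dvd 4 * l + 1" for d :: nat
  proof
    assume *: "d dvd l + 1"
    then have "d dvd 3" using dvd_diff_nat[OF dvd_mult[of d "l + 1" 4] d] three(1) by simp
    then show "d dvd 2 * l - 1" using dvd_diff_nat[OF dvd_mult[OF *, of 2]] three(3) by metis
  next
    assume *: "d dvd 2 * l - 1"
    then have "d dvd 3" using dvd_diff_nat[OF d dvd_mult[OF *, of 2]] three(2) by simp
    then show "d dvd l + 1" using dvd_diff_nat[OF d dvd_mult[of d 3 l]] three(4) by metis
  qed
  then show ?thesis by (intro dvd_antisym gcd_greatest) auto
qed

lemma missing_rotation_of_decomposition:
  assumes l: "l > 0" and p: "p > 0" and q: "q > 0" and N: "2 * l = p * q + r"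
    and r: "p \<le> 2 * r" "r \<le> 20" and i: "i < 4 * l + 1"
    and eq: "gcd i (4 * l + 1) = gcd (2 * l + 1 - p) (4 * l + 1)"
  shows "has_S_sequencing (dihedral (4 * l + 1)) (carrier (dihedral (4 * l + 1)) -
    {\<one>\<^bsub>dihedral (4 * l + 1)\<^esub>, (i, False)})"
proof -
  let ?m = "4 * l + 1"
  have r1: "1 \<le> r" using p r by simp
  have par: "even p \<longrightarrow> even r" using N by (metis dvd_triv_left even_add even_mult_iff)
  have pN: "p \<le> 2 * l" using N q by (metis le_add1 mult.right_neutral mult_le_mono2 One_nat_def Suc_leI le_trans)
  let ?exc = "exceptional (int r) (zigzag_start (int r) p)"
  obtain s where s: "twizzled p s" "length s = (if ?exc then r + p else r)"
    using twizzled_seed[OF r1 r(2) _ r(1) par] p by auto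
  \<comment> \<open>An exceptional seed already accounts for one of the \<open>q\<close> blocks;
    when \<open>q = 1\<close>, no twist remains to determine the first gap.\<close>
  consider "p = 1" | "p > 1" "?exc" "q = 1" | "p > 1" "\<not> ?exc \<or> q > 1"
    using p q by linarith
  then show ?thesis
  proof cases
    case 1
    have "coprime (2 * l) ?m" using coprime_mult_add_1[of "2 * l" 2] by simp
    then show ?thesis using missing_generator[OF l i] eq 1 by (simp add: coprime_iff_gcd_eq_1)
  next
    case 2
    \<comment> \<open>Now $p = r$ or $p = r + 2$, and $u^{2l+1-p}$ has the same order as $u^{2l-1}$ (the case $p = 2$)
      or $u$, respectively.\<close>
    have "even (p + r)" using N 2(3) by (metis dvd_triv_left mult.right_neutral)
    then have "p = r \<or> p = r + 2"
      using 2(2) by (auto simp: exceptional_def near_middle_def zigzag_start_def elim!: evenE oddE split: if_splits)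
    then show ?thesis
    proof
      assume "p = r + 2"
      then have "2 * l + 1 - p = l" using N 2(3) by simp
      moreover have "coprime l ?m" using coprime_mult_add_1[of l 4] by simp
      ultimately show ?thesis using missing_generator[OF l i] eq by (simp add: coprime_iff_gcd_eq_1)
    next
      assume "p = r"
      then have pl: "p = l" using N 2(3) by simp
      \<comment> \<open>Period 2 replaces \<open>p\<close>: two entries and l - 1 blocks of two make
        2l, with first gap 2l - 1.\<close>
      obtain s where s: "twizzled 2 s" "length s = 2"
        using twizzled_seed[of 2 2] by (auto simp: exceptional_def)
      obtain xs where xs: "twizzled 2 xs" "length xs = 2 * l" "\<bar>xs ! 1 - xs ! 0\<bar> = int (2 * l - 1)"
        using twizzled_iterate[OF s(1), of "l - 1"] s(2) 2(1) pl by (auto simp: of_nat_diff)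
      show ?thesis
        using gcd_shift[OF l] eq pl by (intro missing_rotation[OF xs(1,2) l xs(3) i]) simp
    qed
  next
    case 3
    obtain xs where xs: "twizzled p xs" "length xs = 2 * l"
      "\<bar>xs ! 1 - xs ! 0\<bar> = int (length xs) + 1 - int p"
    proof (cases ?exc)
      case True
      then obtain q' where "q = Suc q'" "q' > 0" using 3 by (cases q) auto
      moreover have len: "length s + p * q' = 2 * l"
        using s(2) True N \<open>q = Suc q'\<close> by simp
      ultimately show ?thesis
        using twizzled_iterate[OF s(1) p \<open>q' > 0\<close>] 3(1) that len by force
    next
      case False
      then have len: "length s + p * q = 2 * l" using s(2) N by simp
      show ?thesis
        using twizzled_iterate[OF s(1) p q] 3(1) that len by force
    qed
    then have "\<bar>xs ! 1 - xs ! 0\<bar> = int (2 * l + 1 - p)" using pN by (simp add: of_nat_diff)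
    then show ?thesis by (rule missing_rotation[OF xs(1,2) l _ i eq])
  qed
qed

theorem theorem5p4:
  fixes l p q :: nat and r :: int and S :: "(nat \<times> bool) set" and x :: "nat \<times> bool"
  assumes "l > 0" and "p > 0" and "q > 0"
    and "int (2 * l) = int p * int q + r"
    and "real p / 2 \<le> real_of_int r" and "r \<le> 20"
    and "S \<subseteq> carrier (dihedral (4 * l + 1)) - {\<one>\<^bsub>dihedral (4 * l + 1)\<^esub>}"
    and "card S = 8 * l"
    and "x \<in> carrier (dihedral (4 * l + 1)) - {\<one>\<^bsub>dihedral (4 * l + 1)\<^esub>}"
    and "x \<notin> S"
    and "group.ord (dihedral (4 * l + 1)) x =
         group.ord (dihedral (4 * l + 1))
           (dih_u (4 * l + 1) [^]\<^bsub>dihedral (4 * l + 1)\<^esub> (2 * l + 1 - p))"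
  shows "has_S_sequencing (dihedral (4 * l + 1)) S"
proof -
  let ?m = "4 * l + 1" and ?t = "2 * l + 1 - p"
  define r' where "r' = nat r"
  have pr: "int p \<le> 2 * r" using assms(5) by linarith
  then have r': "int r' = r" by (simp add: r'_def)
  then have N: "2 * l = p * q + r'" using assms(4) by (metis of_nat_add of_nat_eq_iff of_nat_mult)
  have bounds: "p \<le> 2 * r'" "r' \<le> 20" using pr r' assms(6) by linarith+
  have u: "dih_u ?m [^]\<^bsub>dihedral ?m\<^esub> ?t = (?t, False)"
    using rotation_pow[of ?m 1 ?t] assms(1,2) by (simp add: dih_u_def)
  have ord: "group.ord (dihedral ?m) x = group.ord (dihedral ?m) (?t, False)"
    using assms(11) u by simp
  have "\<not> snd x"
    using assms(2) by (intro odd_ord_is_rotation[OF _ _ assms(9) ord]) auto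
  then obtain i where x: "x = (i, False)" "i < ?m"
    using assms(9) by (cases x) (auto simp: dihedral_simps)
  have "gcd i ?m = gcd ?t ?m"
    using ord assms(2) unfolding x(1) by (intro gcd_eq_of_ord_eq[OF _ x(2)]) auto
  then have seq: "has_S_sequencing (dihedral ?m) (carrier (dihedral ?m) - {\<one>\<^bsub>dihedral ?m\<^esub>, x})"
    unfolding x(1) by (rule missing_rotation_of_decomposition[OF assms(1-3) N bounds x(2)])
  have fin: "finite (carrier (dihedral ?m))" and card: "card (carrier (dihedral ?m)) = 2 * ?m"
    by (simp_all add: dihedral_simps card_cartesian_product)
  have ne: "\<one>\<^bsub>dihedral ?m\<^esub> \<noteq> x" "\<one>\<^bsub>dihedral ?m\<^esub> \<in> carrier (dihedral ?m)"
      "x \<in> carrier (dihedral ?m)"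
    using assms(9) by (auto simp: dihedral_simps)
  have "card (carrier (dihedral ?m) - {\<one>\<^bsub>dihedral ?m\<^esub>, x}) = 8 * l"
    using ne card fin by (subst card_Diff_subset) auto
  then have "S = carrier (dihedral ?m) - {\<one>\<^bsub>dihedral ?m\<^esub>, x}"
    using assms(7,8,10) fin by (intro card_subset_eq) auto
  then show ?thesis using seq by simp
qed

end
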